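(* Let $p\in(0,2]$ and let $N\ge1$ be an integer. Let $R_{N,p}$ be the positive root of the equation $2(1+r)r^N-p(1-r)^2=0$. If $f(z)=\sum_{n=0}^\infty a_nz^n$ is analytic in the unit disk $\mathbb{D}$ with $\sup_{z\in\mathbb{D}}|f(z)|\le1$, then $$|f(z)|^p+\sum_{n=N}^\infty|a_n|r^n\le1\quad\text{for } |z|=r\le R_{N,p}.$$ The radius $R_{N,p}$ is the best possible: for every $\rho\in(R_{N,p},1)$ there exist such an $f$ and a point $z$ with $|z|=r\le\rho$ for which $|f(z)|^p+\sum_{n=N}^\infty|a_n|r^n>1$.
   Context: $\mathbb{D}=\{z\in\mathbb{C}:|z|<1\}$. *)

theory Defs
  imports "HOL-Complex_Analysis.Complex_Analysis"
begin

definition is_positive_root :: "nat \<Rightarrow> real \<Rightarrow> real \<Rightarrow> bool" where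
  "is_positive_root N p r \<longleftrightarrow> 0 < r \<and> 2 * (1 + r) * r ^ N - p * (1 - r)\<^sup>2 = 0"

text \<open>For \<open>1 \<le> N\<close> and \<open>0 < p \<le> 2\<close> the positive root is unique, so that the description
  below is proper.\<close>
definition bohr_radius :: "nat \<Rightarrow> real \<Rightarrow> real" where
  "bohr_radius N p = (THE r. is_positive_root N p r)"

text \<open>The bound on the unit disk is the supremum bound, stated pointwise because the supremum
  of an unbounded set of reals is unspecified.\<close>
definition bounded_power_series :: "(complex \<Rightarrow> complex) \<Rightarrow> (nat \<Rightarrow> complex) \<Rightarrow> bool" where
  "bounded_power_series f a \<longleftrightarrow>
     f analytic_on ball 0 1 \<and>
     (\<forall>z\<in>ball 0 1. (\<lambda>n. a n * z ^ n) sums f z) \<and>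
     (\<forall>z\<in>ball 0 1. norm (f z) \<le> 1)"

end

theory Submission
  imports Defs
begin

text \<open>
  Write \<open>r = norm z\<close> and \<open>a = norm (a 0)\<close>. Two classical facts control the two summands by the
  same quantity \<open>1 - a\<^sup>2\<close>. Wiener's inequality \<open>norm (a n) \<le> 1 - a\<^sup>2\<close> for \<open>n \<ge> 1\<close> bounds the
  tail by \<open>(1 - a\<^sup>2) * r ^ N / (1 - r)\<close>. The Schwarz-Pick inequality gives
  \<open>1 - (norm (f z))\<^sup>2 \<ge> (1 - a\<^sup>2) * (1 - r) / (1 + r)\<close>, and since \<open>p \<le> 2\<close> the concavity of
  \<open>y \<mapsto> y powr (p / 2)\<close> turns this into
  \<open>1 - norm (f z) powr p \<ge> (p / 2) * (1 - a\<^sup>2) * (1 - r) / (1 + r)\<close>. Hence the claim holds as soon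
  as \<open>r ^ N / (1 - r) \<le> (p / 2) * (1 - r) / (1 + r)\<close>, and this is what \<open>r \<le> bohr_radius N p\<close> says,
  because \<open>2 * (1 + r) * r ^ N - p * (1 - r)\<^sup>2\<close> increases on \<open>[0, 1]\<close>.

  Both classical facts come from one form of the Schwarz-Pick inequality. Wiener's inequality for
  the index \<open>n\<close> is its infinitesimal case \<open>n = 1\<close>, applied to the series
  \<open>\<Sum>k. a (n * k) * w ^ k\<close>; this series is again bounded by 1, since its value at
  \<open>z ^ n\<close> is the average of \<open>f\<close> over the rotations of \<open>z\<close> by the \<open>n\<close>-th roots of unity.

  For the sharpness, take the disk automorphisms \<open>(z + t) / (1 + t * z)\<close> and let \<open>t\<close> tend to 1
  from below. At a real point \<open>r\<close> the quantity to be estimated is a differentiable function of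
  \<open>t\<close> with value 1 at \<open>t = 1\<close> and derivative \<open>p * (1 - r) / (1 + r) - 2 * r ^ N / (1 - r)\<close> there.
  Beyond the radius this derivative is negative, so that the value exceeds 1 for \<open>t\<close> slightly
  below 1.
\<close>

section \<open>The radius\<close>

lemma bohr_equation_strict_mono:
  fixes p :: real
  assumes "0 < p" "1 \<le> N" "0 \<le> r" "r < s" "s \<le> 1"
  shows "2 * (1 + r) * r ^ N - p * (1 - r)\<^sup>2 < 2 * (1 + s) * s ^ N - p * (1 - s)\<^sup>2"
proof -
  have "r ^ N < s ^ N"
    using assms by (intro power_strict_mono) auto
  then have "2 * (1 + r) * r ^ N < 2 * (1 + s) * s ^ N"
    using assms by (intro mult_strict_mono[of "2 * (1 + r)"]) auto
  moreover have "p * (1 - s)\<^sup>2 \<le> p * (1 - r)\<^sup>2"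
    using assms by (intro mult_left_mono power_mono) auto
  ultimately show ?thesis by linarith
qed

text \<open>Strict monotonicity handles \<open>[0, 1]\<close> only; this excludes further roots to the right. For
  \<open>r \<ge> 1\<close> one has \<open>p * (1 - r)\<^sup>2 \<le> 2 * (r - 1)\<^sup>2 < 2 * r\<^sup>2\<close>.\<close>
lemma bohr_equation_pos_beyond_1:
  fixes p :: real
  assumes "0 < p" "p \<le> 2" "1 \<le> N" "1 \<le> r"
  shows "2 * (1 + r) * r ^ N - p * (1 - r)\<^sup>2 > 0"
proof -
  have "p * (1 - r)\<^sup>2 \<le> 2 * (1 - r)\<^sup>2"
    using assms by (intro mult_right_mono) auto
  also have "\<dots> < 2 * (1 + r) * r"
    using assms by (simp add: power2_eq_square algebra_simps)
  also have "\<dots> \<le> 2 * (1 + r) * r ^ N"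
    using assms power_increasing[of 1 N r] by (intro mult_left_mono) auto
  finally show ?thesis by simp
qed

lemma ex1_positive_root:
  assumes "0 < p" "p \<le> 2" "1 \<le> N"
  shows "\<exists>!r. is_positive_root N p r"
proof -
  let ?F = "\<lambda>r::real. 2 * (1 + r) * r ^ N - p * (1 - r)\<^sup>2"
  have "\<exists>r\<ge>0. r \<le> 1 \<and> ?F r = 0"
    using assms by (intro IVT') (auto intro!: continuous_intros simp: power_0_left)
  then obtain r where r: "0 \<le> r" "r \<le> 1" "?F r = 0" by blast
  have "r \<noteq> 0"
    using r assms by (intro notI) (auto simp: power_0_left)
  with r have "is_positive_root N p r"
    by (auto simp: is_positive_root_def)
  moreover have "x = y" if "is_positive_root N p x" "is_positive_root N p y" for x y
  proof -
    have "x < 1" "y < 1"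
      using bohr_equation_pos_beyond_1[OF assms, of x] bohr_equation_pos_beyond_1[OF assms, of y] that
      by (auto simp: is_positive_root_def intro: ccontr)
    then show ?thesis
      using bohr_equation_strict_mono[OF assms(1,3), of x y]
        bohr_equation_strict_mono[OF assms(1,3), of y x] that
      by (auto simp: is_positive_root_def intro: linorder_cases[of x y])
  qed
  ultimately show ?thesis by blast
qed

lemma bohr_radius_positive_root:
  assumes "0 < p" "p \<le> 2" "1 \<le> N"
  shows "is_positive_root N p (bohr_radius N p)"
  unfolding bohr_radius_def by (rule theI'[OF ex1_positive_root[OF assms]])

lemma bohr_radius_less_1:
  assumes "0 < p" "p \<le> 2" "1 \<le> N"
  shows "bohr_radius N p < 1"
  using bohr_radius_positive_root[OF assms] bohr_equation_pos_beyond_1[OF assms, of "bohr_radius N p"]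
  by (auto simp: is_positive_root_def intro: ccontr)

lemma bohr_radius_inside:
  assumes "0 < p" "p \<le> 2" "1 \<le> N" "0 \<le> r" "r \<le> bohr_radius N p"
  shows "r ^ N / (1 - r) \<le> p / 2 * ((1 - r) / (1 + r))"
proof -
  note R = bohr_radius_positive_root[OF assms(1-3)] bohr_radius_less_1[OF assms(1-3)]
  have "2 * (1 + r) * r ^ N \<le> p * (1 - r)\<^sup>2"
    using bohr_equation_strict_mono[OF assms(1,3,4), of "bohr_radius N p"] R assms(5)
    by (cases "r = bohr_radius N p") (auto simp: is_positive_root_def)
  then show ?thesis
    using assms R by (simp add: field_simps power2_eq_square)
qed

lemma bohr_radius_outside:
  assumes "0 < p" "p \<le> 2" "1 \<le> N" "bohr_radius N p < r" "r < 1"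
  shows "p * ((1 - r) / (1 + r)) < 2 * (r ^ N / (1 - r))"
proof -
  note R = bohr_radius_positive_root[OF assms(1-3)]
  have "p * (1 - r)\<^sup>2 < 2 * (1 + r) * r ^ N"
    using bohr_equation_strict_mono[OF assms(1,3), of "bohr_radius N p" r] R assms
    by (auto simp: is_positive_root_def)
  moreover have "r > 0"
    using R assms by (auto simp: is_positive_root_def)
  ultimately show ?thesis
    using assms by (simp add: field_simps power2_eq_square)
qed

section \<open>The Schwarz-Pick inequality\<close>

lemma norm_moebius_identity:
  fixes a b :: complex
  shows "(norm (1 - cnj a * b))\<^sup>2 - (norm (b - a))\<^sup>2 = (1 - (norm a)\<^sup>2) * (1 - (norm b)\<^sup>2)"
  by (simp only: cmod_power2 minus_complex.simps times_complex.simps cnj.simps one_complex.simps)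
     (simp add: power2_eq_square algebra_simps)

text \<open>The Schwarz lemma for \<open>f\<close> followed by the disk automorphism that moves \<open>f 0\<close> to 0. Clearing
  the denominator keeps the inequality meaningful when the bound on \<open>f\<close> is attained.\<close>
lemma Schwarz_Pick_strict:
  assumes hol: "f holomorphic_on ball 0 1"
    and bound: "\<And>z. norm z < 1 \<Longrightarrow> norm (f z) < 1" and z: "norm z < 1"
  shows "norm (f z - f 0) \<le> norm z * norm (1 - cnj (f 0) * f z)"
proof -
  let ?d = "\<lambda>z. 1 - cnj (f 0) * f z"
  have nz: "?d w \<noteq> 0" if "norm w < 1" for w
  proof -
    have "norm (cnj (f 0) * f w) < 1"
      using bound[of 0] bound[OF that] mult_strict_mono'[of "norm (f 0)" 1 "norm (f w)" 1]
      by (simp add: norm_mult)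
    then show ?thesis by auto
  qed
  have "norm ((f z - f 0) / ?d z) \<le> norm z"
  proof (rule Schwarz_Lemma(1))
    show "(\<lambda>z. (f z - f 0) / ?d z) holomorphic_on ball 0 1"
      using nz by (intro holomorphic_intros hol) auto
    fix w :: complex assume w: "norm w < 1"
    have "(norm (?d w))\<^sup>2 - (norm (f w - f 0))\<^sup>2 > 0"
      unfolding norm_moebius_identity using bound[of 0] bound[OF w]
      by (intro mult_pos_pos) (auto simp: power_less_one_iff abs_square_less_1)
    then have "norm (f w - f 0) < norm (?d w)"
      by (intro power2_less_imp_less[of "norm (f w - f 0)"]) auto
    then show "norm ((f w - f 0) / ?d w) < 1"
      using nz[OF w] by (simp add: norm_divide)
  qed (use z in auto)
  then show ?thesis
    using nz[OF z] by (simp add: norm_divide field_simps)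
qed

text \<open>The factors \<open>t < 1\<close> make the bound strict, and the inequality survives the limit \<open>t \<rightarrow> 1\<close>;
  this covers unimodular constants without the maximum principle.\<close>
lemma Schwarz_Pick:
  assumes hol: "f holomorphic_on ball 0 1"
    and bound: "\<And>z. norm z < 1 \<Longrightarrow> norm (f z) \<le> 1" and z: "norm z < 1"
  shows "norm (f z - f 0) \<le> norm z * norm (1 - cnj (f 0) * f z)"
proof -
  let ?L = "\<lambda>t::real. norm (of_real t * f z - of_real t * f 0)"
  let ?R = "\<lambda>t::real. norm z * norm (1 - cnj (of_real t * f 0) * (of_real t * f z))"
  have le: "?L t \<le> ?R t" if t: "0 < t" "t < 1" for t
  proof (rule Schwarz_Pick_strict[where f = "\<lambda>w. of_real t * f w"])
    show "norm (of_real t * f w) < 1" if "norm w < 1" for w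
    proof -
      have "t * norm (f w) \<le> t * 1"
        using bound[OF that] t by (intro mult_left_mono) auto
      also have "\<dots> < 1" using t by simp
      finally show ?thesis using t by (simp add: norm_mult)
    qed
  qed (use z hol in \<open>auto intro!: holomorphic_intros\<close>)
  have "(?L \<longlongrightarrow> ?L 1) (at_left 1)" "(?R \<longlongrightarrow> ?R 1) (at_left 1)"
    by (intro tendsto_intros)+
  moreover have "\<forall>\<^sub>F t in at_left 1. ?L t \<le> ?R t"
    using eventually_at_left_real[of 0 1] by (rule eventually_mono) (use le in auto)
  ultimately have "?L 1 \<le> ?R 1"
    by (intro tendsto_le[of "at_left 1"]) auto
  then show ?thesis by simp
qed

text \<open>How fast \<open>norm (f z)\<close> can approach 1. Squaring the Schwarz-Pick inequality and inserting
  \<open>norm_moebius_identity\<close> gives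
  \<open>(1 - \<bar>z\<bar>\<^sup>2) * \<bar>1 - cnj a * b\<bar>\<^sup>2 \<le> (1 - \<bar>a\<bar>\<^sup>2) * (1 - \<bar>b\<bar>\<^sup>2)\<close> for \<open>a = f 0\<close> and \<open>b = f z\<close>, so
  that a lower bound for \<open>\<bar>1 - cnj a * b\<bar>\<close> is all that remains.\<close>
lemma one_minus_norm_sq_lower:
  assumes hol: "f holomorphic_on ball 0 1"
    and bound: "\<And>z. norm z < 1 \<Longrightarrow> norm (f z) \<le> 1" and z: "norm z < 1"
  shows "(1 - (norm (f 0))\<^sup>2) * ((1 - norm z) / (1 + norm z)) \<le> 1 - (norm (f z))\<^sup>2"
proof (cases "norm (f 0) = 1")
  case True
  then show ?thesis
    using bound[OF z] by (simp add: abs_square_le_1)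
next
  case False
  let ?A = "1 - (norm (f 0))\<^sup>2" and ?X = "1 - (norm (f z))\<^sup>2" and ?r = "norm z"
  let ?D = "norm (1 - cnj (f 0) * f z)"
  have f0: "norm (f 0) < 1" using bound[of 0] False by simp
  then have A: "?A > 0" by (simp add: abs_square_less_1)
  have SP: "norm (f z - f 0) \<le> ?r * ?D"
    by (rule Schwarz_Pick[OF assms])
  \<comment> \<open>A lower bound for the denominator: \<open>1 - \<bar>a\<bar>\<^sup>2 = (1 - cnj a * b) + cnj a * (b - a)\<close>.\<close>
  have "of_real ?A = (1 - cnj (f 0) * f z) + cnj (f 0) * (f z - f 0)"
    by (simp add: algebra_simps complex_norm_square del: of_real_power)
  then have "?A = norm ((1 - cnj (f 0) * f z) + cnj (f 0) * (f z - f 0))"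
    using A by (metis norm_of_real abs_of_pos)
  also have "\<dots> \<le> ?D + norm (f 0) * norm (f z - f 0)"
    by (metis norm_triangle_ineq norm_mult complex_mod_cnj)
  also have "\<dots> \<le> ?D + 1 * (?r * ?D)"
    using SP f0 by (intro add_left_mono mult_mono) auto
  finally have "?A / (1 + ?r) \<le> ?D"
    by (simp add: field_simps add_pos_nonneg)
  then have "(?A / (1 + ?r))\<^sup>2 \<le> ?D\<^sup>2"
    using A by (intro power_mono) auto
  then have "(1 - ?r\<^sup>2) * (?A / (1 + ?r))\<^sup>2 \<le> (1 - ?r\<^sup>2) * ?D\<^sup>2"
    using z by (intro mult_left_mono) (auto simp: abs_square_le_1)
  also have "\<dots> \<le> ?D\<^sup>2 - (norm (f z - f 0))\<^sup>2"
    using power_mono[OF SP, of 2] by (simp add: power_mult_distrib algebra_simps)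
  also have "\<dots> = ?A * ?X" by (rule norm_moebius_identity)
  also have "(1 - ?r\<^sup>2) * (?A / (1 + ?r))\<^sup>2 = ?A * (?A * ((1 - ?r) / (1 + ?r)))"
  proof -
    have "1 + ?r \<noteq> 0" using norm_ge_zero[of z] by linarith
    then show ?thesis
      by (simp add: divide_simps) (simp add: power2_eq_square algebra_simps)
  qed
  finally show ?thesis
    using A by (rule mult_left_le_imp_le)
qed

lemma power_series_deriv_0:
  fixes b :: "nat \<Rightarrow> complex"
  assumes sums: "\<And>z. norm z < 1 \<Longrightarrow> (\<lambda>k. b k * z ^ k) sums h z"
  shows "(h has_field_derivative b 1) (at 0)"
proof -
  have "summable (\<lambda>k. b k * (1 / 2) ^ k)"
    using sums[of "1 / 2"] by (auto simp: sums_iff norm_divide)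
  then have "((\<lambda>x. \<Sum>k. b k * x ^ k) has_field_derivative (\<Sum>k. diffs b k * 0 ^ k)) (at 0)"
    by (rule termdiffs_strong) (simp add: norm_divide)
  moreover have "(\<Sum>k. diffs b k * 0 ^ k) = b 1"
    by (simp add: powser_zero diffs_def)
  ultimately have "((\<lambda>x. \<Sum>k. b k * x ^ k) has_field_derivative b 1) (at 0)" by simp
  then show ?thesis
    by (rule has_field_derivative_transform_within_open[where S = "ball 0 1"])
       (use sums in \<open>auto simp: sums_iff\<close>)
qed

text \<open>Divide \<open>Schwarz_Pick\<close> by \<open>norm w\<close> and let \<open>w\<close> tend to 0.\<close>
lemma Schwarz_Pick_deriv:
  assumes hol: "h holomorphic_on ball 0 1"
    and bound: "\<And>z. norm z < 1 \<Longrightarrow> norm (h z) \<le> 1"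
    and deriv: "(h has_field_derivative d) (at 0)"
  shows "norm d \<le> 1 - (norm (h 0))\<^sup>2"
proof -
  have "((\<lambda>w. (h w - h 0) / w) \<longlongrightarrow> d) (at 0)"
    using deriv by (simp add: has_field_derivative_iff)
  then have L: "((\<lambda>w. norm ((h w - h 0) / w)) \<longlongrightarrow> norm d) (at 0)"
    by (rule tendsto_norm)
  have "(h \<longlongrightarrow> h 0) (at 0)"
    using DERIV_isCont[OF deriv] by (simp add: isCont_def)
  then have R: "((\<lambda>w. norm (1 - cnj (h 0) * h w)) \<longlongrightarrow> norm (1 - cnj (h 0) * h 0)) (at 0)"
    by (intro tendsto_intros)
  have "\<forall>\<^sub>F w in at 0. norm ((h w - h 0) / w) \<le> norm (1 - cnj (h 0) * h w)"
    unfolding eventually_at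
  proof (intro exI[of _ 1] conjI ballI impI)
    fix w :: complex assume "w \<noteq> 0 \<and> dist w 0 < 1"
    then show "norm ((h w - h 0) / w) \<le> norm (1 - cnj (h 0) * h w)"
      using Schwarz_Pick[OF hol bound, of w] by (simp add: norm_divide field_simps)
  qed auto
  then have "norm d \<le> norm (1 - cnj (h 0) * h 0)"
    by (intro tendsto_le[OF _ R L]) auto
  also have "1 - cnj (h 0) * h 0 = of_real (1 - (norm (h 0))\<^sup>2)"
    by (simp add: complex_norm_square algebra_simps del: of_real_power)
  also have "norm \<dots> = 1 - (norm (h 0))\<^sup>2"
    using bound[of 0] by (subst norm_of_real) (simp add: abs_square_le_1)
  finally show ?thesis .
qed

section \<open>Wiener's coefficient inequality\<close>

lemma sum_powers_root_of_unity:
  fixes n m :: nat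
  assumes "1 \<le> n"
  defines "\<omega> \<equiv> exp (2 * of_real pi * \<i> * of_nat 1 / of_nat n)"
  shows "(\<Sum>j<n. (\<omega> ^ j) ^ m) = (if n dvd m then of_nat n else 0)"
proof -
  have \<omega>: "\<omega> ^ m = exp (2 * of_real pi * \<i> * of_nat m / of_nat n)" for m
    unfolding \<omega>_def by (simp add: exp_of_nat_mult[symmetric] mult_ac)
  then have eq1: "\<omega> ^ m = 1 \<longleftrightarrow> n dvd m" for m
    using complex_root_unity_eq_1[OF assms(1)] by simp
  have "(\<Sum>j<n. (\<omega> ^ j) ^ m) = (\<Sum>j<n. (\<omega> ^ m) ^ j)"
    by (simp add: power_mult[symmetric] mult.commute)
  also have "\<dots> = (if n dvd m then of_nat n else 0)"
  proof (cases "n dvd m")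
    case True
    then show ?thesis using eq1[of m] by simp
  next
    case False
    have "(\<omega> ^ m) ^ n = 1"
      using eq1[of "m * n"] by (simp add: power_mult)
    then show ?thesis using False eq1[of m] by (simp add: sum_gp_strict)
  qed
  finally show ?thesis .
qed

text \<open>Averaging over the rotations by \<open>n\<close>-th roots of unity retains the terms whose index is a
  multiple of \<open>n\<close>.\<close>
lemma sparse_series_average:
  fixes a :: "nat \<Rightarrow> complex"
  assumes n: "1 \<le> n" and sums: "\<And>z. norm z < 1 \<Longrightarrow> (\<lambda>m. a m * z ^ m) sums f z"
    and z: "norm z < 1"
  defines "\<omega> \<equiv> exp (2 * of_real pi * \<i> * of_nat 1 / of_nat n)"
  shows "(\<lambda>k. a (n * k) * (z ^ n) ^ k) sums ((\<Sum>j<n. f (\<omega> ^ j * z)) / of_nat n)"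
proof -
  have norm_rot: "norm (\<omega> ^ j * z) < 1" for j
    using z by (simp add: \<omega>_def norm_mult norm_power)
  have "(\<lambda>m. \<Sum>j<n. a m * (\<omega> ^ j * z) ^ m) sums (\<Sum>j<n. f (\<omega> ^ j * z))"
    by (intro sums_sum sums norm_rot)
  then have "(\<lambda>m. (\<Sum>j<n. a m * (\<omega> ^ j * z) ^ m) / of_nat n) sums ((\<Sum>j<n. f (\<omega> ^ j * z)) / of_nat n)"
    by (rule sums_divide)
  also have "(\<lambda>m. (\<Sum>j<n. a m * (\<omega> ^ j * z) ^ m) / of_nat n) =
    (\<lambda>m. if n dvd m then a m * z ^ m else 0)"
  proof
    fix m
    have "(\<Sum>j<n. a m * (\<omega> ^ j * z) ^ m) = a m * z ^ m * (\<Sum>j<n. (\<omega> ^ j) ^ m)"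
      by (simp add: sum_distrib_left power_mult_distrib mult_ac)
    then show "(\<Sum>j<n. a m * (\<omega> ^ j * z) ^ m) / of_nat n = (if n dvd m then a m * z ^ m else 0)"
      using n sum_powers_root_of_unity[OF n, of m] by (simp add: \<omega>_def)
  qed
  finally have "(\<lambda>m. if n dvd m then a m * z ^ m else 0) sums ((\<Sum>j<n. f (\<omega> ^ j * z)) / of_nat n)" .
  moreover have "strict_mono ((*) n)"
    using n by (intro strict_monoI) auto
  ultimately have "(\<lambda>k. if n dvd n * k then a (n * k) * z ^ (n * k) else 0)
      sums ((\<Sum>j<n. f (\<omega> ^ j * z)) / of_nat n)"
    by (subst sums_mono_reindex[of "(*) n"]) auto
  then show ?thesis by (simp add: power_mult)
qed

text \<open>In the sparse series the coefficient \<open>a n\<close> has index 1, so it is a derivative at the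
  origin. Every point of the disk is an \<open>n\<close>-th power, hence the series is bounded by an average of
  values of \<open>f\<close>.\<close>
lemma Wiener_coefficient_bound:
  fixes a :: "nat \<Rightarrow> complex"
  assumes n: "1 \<le> n" and sums: "\<And>z. norm z < 1 \<Longrightarrow> (\<lambda>m. a m * z ^ m) sums f z"
    and bound: "\<And>z. norm z < 1 \<Longrightarrow> norm (f z) \<le> 1"
  shows "norm (a n) \<le> 1 - (norm (a 0))\<^sup>2"
proof -
  define \<omega> where "\<omega> = exp (2 * of_real pi * \<i> * of_nat 1 / of_nat n)"
  define h where "h = (\<lambda>w. \<Sum>k. a (n * k) * w ^ k)"
  have h: "(\<lambda>k. a (n * k) * w ^ k) sums h w \<and> norm (h w) \<le> 1" if w: "norm w < 1" for w
  proof -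
    obtain z where z: "z ^ n = w"
      using n exists_complex_root[of n w] by auto
    then have "norm z ^ n < 1" using w by (auto simp: norm_power)
    then have nz: "norm z < 1"
      by (meson linorder_not_le one_le_power)
    have S: "(\<lambda>k. a (n * k) * w ^ k) sums ((\<Sum>j<n. f (\<omega> ^ j * z)) / of_nat n)"
      using sparse_series_average[OF n sums nz] z by (simp add: \<omega>_def)
    have "norm (\<Sum>j<n. f (\<omega> ^ j * z)) \<le> (\<Sum>j<n. 1)"
      by (rule sum_norm_le, rule bound) (use nz in \<open>simp add: \<omega>_def norm_mult norm_power\<close>)
    then have "norm ((\<Sum>j<n. f (\<omega> ^ j * z)) / of_nat n) \<le> 1"
      using n by (simp add: norm_divide)
    with S show ?thesis by (auto simp: h_def sums_iff)
  qed
  have "h holomorphic_on ball 0 1"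
    by (rule power_series_holomorphic[where a = "\<lambda>k. a (n * k)"]) (use h in auto)
  moreover have "(h has_field_derivative a (n * 1)) (at 0)"
    by (rule power_series_deriv_0[where b = "\<lambda>k. a (n * k)"]) (use h in auto)
  moreover have "h 0 = a 0"
    by (simp add: h_def powser_zero)
  ultimately show ?thesis
    using Schwarz_Pick_deriv[of h "a n"] h by simp
qed

section \<open>The inequality within the radius\<close>

text \<open>The right-hand side is the tangent at \<open>y = 1\<close> of the concave function
  \<open>y \<mapsto> y powr (p / 2)\<close>, taken at \<open>y = x\<^sup>2\<close>; the inequality is the weighted mean inequality for
  \<open>x\<^sup>2\<close> and 1.\<close>
lemma powr_le_tangent:
  fixes x p :: real
  assumes "0 \<le> x" "0 < p" "p \<le> 2"
  shows "x powr p \<le> 1 - p / 2 * (1 - x\<^sup>2)"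
proof (cases "x = 0")
  case False
  have "(x\<^sup>2) powr (p / 2) * 1 powr (1 - p / 2) \<le> p / 2 * x\<^sup>2 + (1 - p / 2) * 1"
    using assms False by (intro Youngs_inequality_0) auto
  moreover have "(x\<^sup>2) powr (p / 2) = x powr p"
    using assms False by (simp add: powr_powr flip: powr_numeral)
  ultimately show ?thesis by (simp add: algebra_simps)
qed (use assms in auto)

lemma has_sum_geometric_tail:
  fixes q :: real
  assumes "0 \<le> q" "q < 1"
  shows "((\<lambda>n. q ^ n) has_sum (q ^ N / (1 - q))) {N..}"
proof -
  have "(\<lambda>k. q ^ N * q ^ k) sums (q ^ N * (1 / (1 - q)))"
    using assms by (intro sums_mult geometric_sums) auto
  then have "((\<lambda>k. q ^ N * q ^ k) has_sum (q ^ N / (1 - q))) UNIV"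
    using assms by (intro sums_nonneg_imp_has_sum) auto
  also have "(\<lambda>k. q ^ N * q ^ k) = (\<lambda>n. q ^ n) \<circ> (+) N"
    by (simp add: fun_eq_iff power_add)
  finally have "(((\<lambda>n. q ^ n) \<circ> (+) N) has_sum (q ^ N / (1 - q))) UNIV" .
  moreover have range: "range ((+) N) = {N..}"
    by (auto simp: image_iff le_iff_add)
  ultimately show ?thesis
    using has_sum_reindex[of "(+) N" UNIV "\<lambda>n. q ^ n"] by (simp add: range)
qed

lemma bohr_inequality:
  assumes p: "0 < p" "p \<le> 2" "1 \<le> N"
    and f: "bounded_power_series f a" and z: "norm z \<le> bohr_radius N p"
  shows "(\<lambda>n. norm (a n) * norm z ^ n) summable_on {N..}"
    and "norm (f z) powr p + (\<Sum>\<^sub>\<infinity>n\<in>{N..}. norm (a n) * norm z ^ n) \<le> 1"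
proof -
  let ?r = "norm z" and ?A = "1 - (norm (a 0))\<^sup>2"
  have r: "?r < 1" using z bohr_radius_less_1[OF p] by linarith
  have hol: "f holomorphic_on ball 0 1"
    and sums: "\<And>z. norm z < 1 \<Longrightarrow> (\<lambda>n. a n * z ^ n) sums f z"
    and bound: "\<And>z. norm z < 1 \<Longrightarrow> norm (f z) \<le> 1"
    using f by (auto simp: bounded_power_series_def intro: analytic_imp_holomorphic)
  have f0: "f 0 = a 0"
    using sums[of 0] powser_zero[of a] by (simp add: sums_iff)
  have A: "?A \<ge> 0"
    using bound[of 0] f0 by (simp add: abs_square_le_1)
  have le: "norm (a n) * ?r ^ n \<le> ?A * ?r ^ n" if "n \<in> {N..}" for n
    using Wiener_coefficient_bound[OF _ sums bound, of n] that p by (intro mult_right_mono) auto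
  have geo: "((\<lambda>n. ?A * ?r ^ n) has_sum (?A * (?r ^ N / (1 - ?r)))) {N..}"
    using r by (intro has_sum_cmult_right has_sum_geometric_tail) auto
  show summable: "(\<lambda>n. norm (a n) * ?r ^ n) summable_on {N..}"
    by (rule summable_on_comparison_test[OF has_sum_imp_summable[OF geo] le]) auto
  have "(\<Sum>\<^sub>\<infinity>n\<in>{N..}. norm (a n) * ?r ^ n) \<le> ?A * (?r ^ N / (1 - ?r))"
    using has_sum_mono[OF has_sum_infsum[OF summable] geo le] .
  also have "\<dots> \<le> ?A * (p / 2 * ((1 - ?r) / (1 + ?r)))"
    using A z by (intro mult_left_mono bohr_radius_inside p) auto
  also have "\<dots> = p / 2 * (?A * ((1 - ?r) / (1 + ?r)))" by simp
  also have "\<dots> \<le> p / 2 * (1 - (norm (f z))\<^sup>2)"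
    using one_minus_norm_sq_lower[OF hol bound r] p f0 by (intro mult_left_mono) auto
  finally show "norm (f z) powr p + (\<Sum>\<^sub>\<infinity>n\<in>{N..}. norm (a n) * ?r ^ n) \<le> 1"
    using powr_le_tangent[of "norm (f z)" p] p by simp
qed

section \<open>Sharpness of the radius\<close>

definition moebius_coeff :: "real \<Rightarrow> nat \<Rightarrow> complex" where
  "moebius_coeff t n = (if n = 0 then of_real t else of_real ((1 - t\<^sup>2) * (- t) ^ (n - 1)))"

lemma moebius_bounded_power_series:
  assumes t: "0 < t" "t < 1"
  shows "bounded_power_series (\<lambda>z. (z + of_real t) / (1 + of_real t * z)) (moebius_coeff t)"
proof -
  let ?f = "\<lambda>z::complex. (z + of_real t) / (1 + of_real t * z)"
  have small: "norm (of_real t * z) < 1" if "norm z < 1" for z :: complex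
  proof -
    have "t * norm z \<le> t * 1" using that t by (intro mult_left_mono) auto
    also have "\<dots> < 1" using t by simp
    finally show ?thesis using t by (simp add: norm_mult)
  qed
  have nz: "1 + of_real t * z \<noteq> 0" if "norm z < 1" for z :: complex
  proof
    assume "1 + of_real t * z = 0"
    then have "of_real t * z = - 1" by (simp add: eq_neg_iff_add_eq_0 add.commute)
    with small[OF that] show False by simp
  qed
  have sums: "(\<lambda>n. moebius_coeff t n * z ^ n) sums ?f z" if z: "norm z < 1" for z
  proof -
    have "(\<lambda>n. (of_real (1 - t\<^sup>2) * z) * (- (of_real t * z)) ^ n) sums
        ((of_real (1 - t\<^sup>2) * z) * (1 / (1 - (- (of_real t * z)))))"
      using small[OF z] by (intro sums_mult geometric_sums) simp
    moreover have "(of_real (1 - t\<^sup>2) * z) * (- (of_real t * z)) ^ n =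
        moebius_coeff t (Suc n) * z ^ Suc n" for n
      by (simp add: moebius_coeff_def power_mult_distrib[symmetric] mult_ac)
    ultimately have "(\<lambda>n. moebius_coeff t (Suc n) * z ^ Suc n) sums
        (of_real (1 - t\<^sup>2) * z * (1 / (1 - (- (of_real t * z)))))"
      by (simp only:)
    from sums_Suc[OF this] have "(\<lambda>n. moebius_coeff t n * z ^ n) sums
        (of_real (1 - t\<^sup>2) * z / (1 + of_real t * z) + moebius_coeff t 0 * z ^ 0)"
      by simp
    moreover have "of_real (1 - t\<^sup>2) * z / (1 + of_real t * z) + moebius_coeff t 0 * z ^ 0 = ?f z"
      using nz[OF z] by (simp add: moebius_coeff_def divide_simps) (simp add: power2_eq_square algebra_simps)
    ultimately show ?thesis by simp
  qed
  have bound: "norm (?f z) \<le> 1" if z: "norm z < 1" for z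
  proof -
    have "(norm (1 + of_real t * z))\<^sup>2 - (norm (z + of_real t))\<^sup>2 = (1 - t\<^sup>2) * (1 - (norm z)\<^sup>2)"
      using norm_moebius_identity[of "- of_real t" z] by simp
    also have "\<dots> \<ge> 0"
      using t z by (intro mult_nonneg_nonneg) (auto simp: abs_square_le_1)
    finally have "norm (z + of_real t) \<le> norm (1 + of_real t * z)"
      by (intro power2_le_imp_le[of "norm (z + of_real t)"]) auto
    then show ?thesis using nz[OF z] by (simp add: norm_divide)
  qed
  have "?f analytic_on ball 0 1"
    using nz by (intro analytic_intros) auto
  with sums bound show ?thesis
    by (auto simp: bounded_power_series_def)
qed

lemma moebius_tail_has_sum:
  assumes t: "0 < t" "t < 1" and r: "0 \<le> r" "r < 1" and N: "1 \<le> N"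
  shows "((\<lambda>n. norm (moebius_coeff t n) * r ^ n) has_sum
    ((1 - t\<^sup>2) * t ^ (N - 1) * r ^ N / (1 - t * r))) {N..}"
proof -
  have "t * r \<le> 1 * r" using t r by (intro mult_right_mono) auto
  then have "t * r < 1" using r by simp
  then have "((\<lambda>n. (1 - t\<^sup>2) / t * (t * r) ^ n) has_sum
      ((1 - t\<^sup>2) / t * ((t * r) ^ N / (1 - t * r)))) {N..}"
    using t r by (intro has_sum_cmult_right has_sum_geometric_tail) auto
  also have "(1 - t\<^sup>2) / t * ((t * r) ^ N / (1 - t * r)) = (1 - t\<^sup>2) * t ^ (N - 1) * r ^ N / (1 - t * r)"
    using t N by (cases N) (auto simp: power_mult_distrib)
  finally show ?thesis
  proof (rule has_sum_cong[THEN iffD1, rotated])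
    fix n assume "n \<in> {N..}"
    then obtain m where "n = Suc m" using N by (cases n) auto
    moreover have "t\<^sup>2 \<le> 1" using t by (simp add: abs_square_le_1)
    ultimately show "(1 - t\<^sup>2) / t * (t * r) ^ n = norm (moebius_coeff t n) * r ^ n"
      using t by (simp add: moebius_coeff_def power_mult_distrib norm_mult norm_power
          flip: of_real_power of_real_mult of_real_diff) (simp add: abs_mult power_abs)
  qed
qed

text \<open>The left-hand side equals 1 at \<open>t = 1\<close>, and beyond the radius its derivative there is
  negative.\<close>
lemma bohr_radius_sharp:
  assumes p: "0 < p" "p \<le> 2" "1 \<le> N" and r: "bohr_radius N p < r" "r < 1"
  shows "\<exists>t. 0 < t \<and> t < 1 \<and>
    ((r + t) / (1 + t * r)) powr p + (1 - t\<^sup>2) * t ^ (N - 1) * r ^ N / (1 - t * r) > 1"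
proof -
  let ?g = "\<lambda>t. ((r + t) / (1 + t * r)) powr p + (1 - t\<^sup>2) * t ^ (N - 1) * r ^ N / (1 - t * r)"
  have r0: "r > 0"
    using bohr_radius_positive_root[OF p] r by (auto simp: is_positive_root_def)
  have D1: "((\<lambda>t. (r + t) / (1 + t * r)) has_real_derivative (1 - r) / (1 + r)) (at 1)"
  proof -
    have "((\<lambda>t. (r + t) / (1 + t * r)) has_real_derivative
        ((1 * (1 + 1 * r) - (r + 1) * (1 * r)) / ((1 + 1 * r) * (1 + 1 * r)))) (at 1)"
      using r0 by (auto intro!: derivative_eq_intros)
    also have "(1 * (1 + 1 * r) - (r + 1) * (1 * r)) / ((1 + 1 * r) * (1 + 1 * r)) = (1 - r) / (1 + r)"
      using r0 by (simp add: divide_simps) (simp add: algebra_simps)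
    finally show ?thesis .
  qed
  have D2: "((\<lambda>t. ((r + t) / (1 + t * r)) powr p) has_real_derivative p * ((1 - r) / (1 + r))) (at 1)"
    by (rule DERIV_cong[OF DERIV_fun_powr[OF D1]]) (use r0 in \<open>auto simp: add.commute\<close>)
  let ?c = "\<lambda>t. t ^ (N - 1) * r ^ N / (1 - t * r)"
  have "?c differentiable (at 1)"
    using r by (auto intro!: derivative_intros)
  then obtain c' where c: "(?c has_real_derivative c') (at 1)"
    by (auto simp: real_differentiable_def)
  \<comment> \<open>The factor \<open>1 - t\<^sup>2\<close> vanishes at 1, so only its own derivative \<open>- 2\<close> matters.\<close>
  have "((\<lambda>t. (1 - t\<^sup>2) * ?c t) has_real_derivative - 2 * (r ^ N / (1 - r))) (at 1)"
    by (rule derivative_eq_intros c refl | simp)+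
  from DERIV_add[OF D2 this]
  have "(?g has_real_derivative (p * ((1 - r) / (1 + r)) - 2 * (r ^ N / (1 - r)))) (at 1)"
    by (simp add: mult.assoc)
  moreover have "p * ((1 - r) / (1 + r)) - 2 * (r ^ N / (1 - r)) < 0"
    using bohr_radius_outside[OF p r] by simp
  ultimately obtain d where d: "d > 0" "\<And>h. 0 < h \<Longrightarrow> h < d \<Longrightarrow> ?g 1 < ?g (1 - h)"
    using DERIV_neg_dec_left[of ?g] by blast
  have "?g 1 = 1" using r0 by (simp add: add.commute)
  define h where "h = min d 1 / 2"
  have "0 < h" "h < d" "h < 1" using d(1) by (auto simp: h_def)
  then show ?thesis
    using d(2)[of h] \<open>?g 1 = 1\<close> by (intro exI[of _ "1 - h"]) auto
qed

theorem lemma1: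
  fixes p :: real and N :: nat
  assumes "0 < p" and "p \<le> 2" and "1 \<le> N"
  shows "(\<exists>!r. is_positive_root N p r) \<and>
    (\<forall>f a z. bounded_power_series f a \<and> norm z \<le> bohr_radius N p \<longrightarrow>
      (\<lambda>n. norm (a n) * norm z ^ n) summable_on {N..} \<and>
      norm (f z) powr p + (\<Sum>\<^sub>\<infinity>n\<in>{N..}. norm (a n) * norm z ^ n) \<le> 1) \<and>
    (\<forall>\<rho>. bohr_radius N p < \<rho> \<and> \<rho> < 1 \<longrightarrow>
      (\<exists>f a z. bounded_power_series f a \<and> norm z \<le> \<rho> \<and>
        (\<lambda>n. norm (a n) * norm z ^ n) summable_on {N..} \<and>
        norm (f z) powr p + (\<Sum>\<^sub>\<infinity>n\<in>{N..}. norm (a n) * norm z ^ n) > 1))"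
proof (intro conjI allI impI)
  show "\<exists>!r. is_positive_root N p r" by (rule ex1_positive_root[OF assms])
next
  fix f a and z :: complex assume "bounded_power_series f a \<and> norm z \<le> bohr_radius N p"
  then show "(\<lambda>n. norm (a n) * norm z ^ n) summable_on {N..}"
    and "norm (f z) powr p + (\<Sum>\<^sub>\<infinity>n\<in>{N..}. norm (a n) * norm z ^ n) \<le> 1"
    using bohr_inequality[OF assms] by auto
next
  fix \<rho> assume \<rho>: "bohr_radius N p < \<rho> \<and> \<rho> < 1"
  have \<rho>0: "\<rho> > 0"
    using bohr_radius_positive_root[OF assms] \<rho> by (auto simp: is_positive_root_def)
  obtain t where t: "0 < t" "t < 1"
    and gt: "((\<rho> + t) / (1 + t * \<rho>)) powr p + (1 - t\<^sup>2) * t ^ (N - 1) * \<rho> ^ N / (1 - t * \<rho>) > 1"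
    using bohr_radius_sharp[OF assms, of \<rho>] \<rho> by blast
  let ?f = "\<lambda>z::complex. (z + of_real t) / (1 + of_real t * z)"
  have "?f (of_real \<rho>) = of_real ((\<rho> + t) / (1 + t * \<rho>))" by simp
  then have val: "norm (?f (of_real \<rho>)) = (\<rho> + t) / (1 + t * \<rho>)"
    using t \<rho>0 by (simp only: norm_of_real) simp
  have norm: "norm (of_real \<rho> :: complex) = \<rho>" using \<rho>0 by simp
  have tail: "((\<lambda>n. norm (moebius_coeff t n) * \<rho> ^ n) has_sum
      ((1 - t\<^sup>2) * t ^ (N - 1) * \<rho> ^ N / (1 - t * \<rho>))) {N..}"
    using t \<rho> \<rho>0 assms(3) by (intro moebius_tail_has_sum) auto
  show "\<exists>f a z. bounded_power_series f a \<and> norm z \<le> \<rho> \<and>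
      (\<lambda>n. norm (a n) * norm z ^ n) summable_on {N..} \<and>
      norm (f z) powr p + (\<Sum>\<^sub>\<infinity>n\<in>{N..}. norm (a n) * norm z ^ n) > 1"
  proof (intro exI conjI)
    show "bounded_power_series ?f (moebius_coeff t)"
      by (rule moebius_bounded_power_series[OF t])
    show "norm (of_real \<rho> :: complex) \<le> \<rho>" by (simp only: norm)
    show "(\<lambda>n. norm (moebius_coeff t n) * norm (of_real \<rho> :: complex) ^ n) summable_on {N..}"
      unfolding norm by (rule has_sum_imp_summable[OF tail])
    show "norm (?f (of_real \<rho>)) powr p +
        (\<Sum>\<^sub>\<infinity>n\<in>{N..}. norm (moebius_coeff t n) * norm (of_real \<rho> :: complex) ^ n) > 1"
      unfolding norm val infsumI[OF tail] by (rule gt)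
  qed
qed

end
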